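(* Let $N$, $c_n(E)$ and the real parameters be as in the context; in particular $N=-\lambda_1-\alpha_1\in\mathbb{Z}_{\ge 0}$, $\beta<1$, $\alpha_2-\alpha_1<1$, $t_1,t_2>0$, $h_1<h_2$, $l_1<l_2$. Assume that $2N+1+h_2-l_2-\beta<0$ and $l_1-l_2-\beta\notin\{-2N,-2N+2,\dots,-4,-2\}$. Set $$p_n(E)=\left(Eq^{n-1+\lambda_1-h_1-h_2}+q^{2n-1/2-l_2-\beta}\right)\left(Eq^{n-2+\lambda_1-h_1-h_2}+q^{2n-2-1/2-l_2-\beta}\right)-q^{2n-1-l_1-l_2-\beta},$$ and $$\tilde c_{N+1}(E)=\prod_{n=1}^{(N+1)/2}p_{2n}(E)\ \text{ if } N\text{ is odd},\qquad \tilde c_{N+1}(E)=\left(Eq^{\lambda_1-h_1-h_2}+q^{3/2-l_2-\beta}\right)\prod_{n=1}^{N/2}p_{2n+1}(E)\ \text{ if } N\text{ is even}.$$ Then $c_{N+1}(E)\approx\tilde c_{N+1}(E)$.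
   Context: Throughout $0<q<1$, and $h_1,h_2,l_1,l_2,\alpha_1,\alpha_2,\beta,t_1,t_2$ are fixed real parameters independent of $q$. Put $\lambda_1=\frac{h_1+h_2-l_1-l_2-\alpha_1-\alpha_2-\beta+2}{2}$. Standing assumption: $N:=-\lambda_1-\alpha_1\in\mathbb{Z}_{\ge 0}$, $\beta<1$, $\alpha_2-\alpha_1<1$, $t_1>0$, $t_2>0$, $h_1<h_2$, $l_1<l_2$. The polynomials $c_n(E)$ in the indeterminate $E$ (of degree $n$, with coefficients depending on $q$) are defined by $c_{-1}(E)=0$, $c_0(E)=1$ and, for $n=1,\dots,N+1$, $$c_n(E)\,t_1t_2\,q^{h_1+h_2}(1-q^n)(1-q^{n-\beta})=c_{n-1}(E)\left[Eq^{n-1+\lambda_1}+q^{1/2}(q^{h_1}t_1+q^{h_2}t_2)+(q^{l_1}t_1+q^{l_2}t_2)q^{2(n+\lambda_1)+\alpha_1+\alpha_2-5/2}\right]-c_{n-2}(E)\,q(1-q^{n-2+\lambda_1+\alpha_1})(1-q^{n-2+\lambda_1+\alpha_2}).$$ The polynomial $c_{N+1}(E)$ is called the spectral polynomial of the $q$-Heun equation. For functions of $q$, $a(q)\approx b(q)$ means that there exists $C>0$ with $\lim_{q\to+0}a(q)/b(q)=C$. For polynomials in $E$ with $q$-dependent coefficients, $\sum_{j=0}^{M}a_j(q)E^j\approx\sum_{j=0}^{M}b_j(q)E^j$ means $a_j(q)\approx b_j(q)$ for every $j=0,\dots,M$ (the constant $C$ may depend on $j$). *)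

theory Defs
  imports "HOL-Computational_Algebra.Polynomial" Complex_Main
begin

definition heun_lambda ::
  "real \<Rightarrow> real \<Rightarrow> real \<Rightarrow> real \<Rightarrow> real \<Rightarrow> real \<Rightarrow> real \<Rightarrow> real" where
  "heun_lambda h1 h2 l1 l2 \<alpha>1 \<alpha>2 \<beta> = (h1 + h2 - l1 - l2 - \<alpha>1 - \<alpha>2 - \<beta> + 2) / 2"

text \<open>
  The recurrence has the shape D(n) c(n) = A(n) c(n-1) - B(n) c(n-2), where A(n) is linear
  in the indeterminate E. A polynomial is written with its constant coefficient first, so that
  \<^term>\<open>[:a, b:]\<close> is a + b E.
\<close>

definition heun_D :: "real \<Rightarrow> real \<Rightarrow> real \<Rightarrow> real \<Rightarrow> real \<Rightarrow> real \<Rightarrow> nat \<Rightarrow> real" where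
  "heun_D h1 h2 \<beta> t1 t2 q n =
     t1 * t2 * q powr (h1 + h2) * (1 - q ^ n) * (1 - q powr (real n - \<beta>))"

definition heun_A ::
  "real \<Rightarrow> real \<Rightarrow> real \<Rightarrow> real \<Rightarrow> real \<Rightarrow> real \<Rightarrow> real \<Rightarrow> real \<Rightarrow> real \<Rightarrow> real \<Rightarrow> nat \<Rightarrow> real poly" where
  "heun_A h1 h2 l1 l2 \<alpha>1 \<alpha>2 \<beta> t1 t2 q n =
     (let \<mu> = heun_lambda h1 h2 l1 l2 \<alpha>1 \<alpha>2 \<beta> in
      [: q powr (1/2) * (q powr h1 * t1 + q powr h2 * t2)
           + (q powr l1 * t1 + q powr l2 * t2) * q powr (2 * (real n + \<mu>) + \<alpha>1 + \<alpha>2 - 5/2),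
         q powr (real n - 1 + \<mu>) :])"

definition heun_B ::
  "real \<Rightarrow> real \<Rightarrow> real \<Rightarrow> real \<Rightarrow> real \<Rightarrow> real \<Rightarrow> real \<Rightarrow> real \<Rightarrow> nat \<Rightarrow> real" where
  "heun_B h1 h2 l1 l2 \<alpha>1 \<alpha>2 \<beta> q n =
     (let \<mu> = heun_lambda h1 h2 l1 l2 \<alpha>1 \<alpha>2 \<beta> in
      q * (1 - q powr (real n - 2 + \<mu> + \<alpha>1)) * (1 - q powr (real n - 2 + \<mu> + \<alpha>2)))"

text \<open>
  The recurrence is solved for c(n), dividing by D(n), which is nonzero whenever
  \<^prop>\<open>0 < q\<close>, \<^prop>\<open>q < 1\<close>, \<^prop>\<open>\<beta> < 1\<close>, \<^prop>\<open>t1 > 0\<close> and \<^prop>\<open>t2 > 0\<close>.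
  The equation for index 1 incorporates c(-1) = 0. The undivided recurrence is
  \<open>heun_c_recurrence\<close> below.
\<close>

fun heun_c ::
  "real \<Rightarrow> real \<Rightarrow> real \<Rightarrow> real \<Rightarrow> real \<Rightarrow> real \<Rightarrow> real \<Rightarrow> real \<Rightarrow> real \<Rightarrow> real \<Rightarrow> nat \<Rightarrow> real poly" where
  "heun_c h1 h2 l1 l2 \<alpha>1 \<alpha>2 \<beta> t1 t2 q 0 = 1"
| "heun_c h1 h2 l1 l2 \<alpha>1 \<alpha>2 \<beta> t1 t2 q (Suc 0) =
     smult (1 / heun_D h1 h2 \<beta> t1 t2 q 1) (heun_A h1 h2 l1 l2 \<alpha>1 \<alpha>2 \<beta> t1 t2 q 1)"
| "heun_c h1 h2 l1 l2 \<alpha>1 \<alpha>2 \<beta> t1 t2 q (Suc (Suc m)) =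
     smult (1 / heun_D h1 h2 \<beta> t1 t2 q (m + 2))
       (heun_c h1 h2 l1 l2 \<alpha>1 \<alpha>2 \<beta> t1 t2 q (Suc m)
          * heun_A h1 h2 l1 l2 \<alpha>1 \<alpha>2 \<beta> t1 t2 q (m + 2)
        - smult (heun_B h1 h2 l1 l2 \<alpha>1 \<alpha>2 \<beta> q (m + 2))
            (heun_c h1 h2 l1 l2 \<alpha>1 \<alpha>2 \<beta> t1 t2 q m))"

lemma heun_D_pos:
  assumes "0 < q" "q < 1" "\<beta> < 1" "t1 > 0" "t2 > 0" "n \<ge> 1"
  shows "heun_D h1 h2 \<beta> t1 t2 q n > 0"
proof -
  have "q ^ n < 1"
    using assms by (simp add: power_less_one_iff)
  moreover have "q powr (real n - \<beta>) < 1"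
    using assms powr_less_mono'[of q 0 "real n - \<beta>"] by simp
  ultimately show ?thesis
    using assms by (simp add: heun_D_def)
qed

lemma heun_c_recurrence:
  fixes h1 h2 l1 l2 \<alpha>1 \<alpha>2 \<beta> t1 t2 q :: real
  defines "c \<equiv> heun_c h1 h2 l1 l2 \<alpha>1 \<alpha>2 \<beta> t1 t2 q"
  assumes "0 < q" "q < 1" "\<beta> < 1" "t1 > 0" "t2 > 0" "n \<ge> 1"
  shows "smult (heun_D h1 h2 \<beta> t1 t2 q n) (c n) =
           c (n - 1) * heun_A h1 h2 l1 l2 \<alpha>1 \<alpha>2 \<beta> t1 t2 q n
           - smult (heun_B h1 h2 l1 l2 \<alpha>1 \<alpha>2 \<beta> q n) (if n = 1 then 0 else c (n - 2))"
proof -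
  have D: "heun_D h1 h2 \<beta> t1 t2 q n \<noteq> 0"
    using heun_D_pos[of q \<beta> t1 t2 n h1 h2] assms by simp
  consider "n = Suc 0" | m where "n = Suc (Suc m)"
    using \<open>n \<ge> 1\<close> by (metis One_nat_def Suc_le_D not0_implies_Suc)
  then show ?thesis
    using D by cases (simp_all add: c_def)
qed

definition heun_p ::
  "real \<Rightarrow> real \<Rightarrow> real \<Rightarrow> real \<Rightarrow> real \<Rightarrow> real \<Rightarrow> real \<Rightarrow> real \<Rightarrow> nat \<Rightarrow> real poly" where
  "heun_p h1 h2 l1 l2 \<alpha>1 \<alpha>2 \<beta> q n =
     (let \<mu> = heun_lambda h1 h2 l1 l2 \<alpha>1 \<alpha>2 \<beta> in
      [: q powr (2 * real n - 1/2 - l2 - \<beta>), q powr (real n - 1 + \<mu> - h1 - h2) :]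
      * [: q powr (2 * real n - 2 - 1/2 - l2 - \<beta>), q powr (real n - 2 + \<mu> - h1 - h2) :]
      - [: q powr (2 * real n - 1 - l1 - l2 - \<beta>) :])"

text \<open>The comparison polynomial for c(N + 1); the last argument is N, not N + 1.\<close>

definition heun_c_tilde ::
  "real \<Rightarrow> real \<Rightarrow> real \<Rightarrow> real \<Rightarrow> real \<Rightarrow> real \<Rightarrow> real \<Rightarrow> real \<Rightarrow> nat \<Rightarrow> real poly" where
  "heun_c_tilde h1 h2 l1 l2 \<alpha>1 \<alpha>2 \<beta> q N =
     (if odd N
      then (\<Prod>n = 1..(N + 1) div 2. heun_p h1 h2 l1 l2 \<alpha>1 \<alpha>2 \<beta> q (2 * n))
      else [: q powr (3/2 - l2 - \<beta>),
              q powr (heun_lambda h1 h2 l1 l2 \<alpha>1 \<alpha>2 \<beta> - h1 - h2) :]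
           * (\<Prod>n = 1..N div 2. heun_p h1 h2 l1 l2 \<alpha>1 \<alpha>2 \<beta> q (2 * n + 1)))"

text \<open>
  Since x / 0 = 0 in HOL, a positive limit of the quotient forces both functions to be
  nonzero for all sufficiently small q > 0.
\<close>

definition asymp_sim :: "(real \<Rightarrow> real) \<Rightarrow> (real \<Rightarrow> real) \<Rightarrow> bool" where
  "asymp_sim a b \<longleftrightarrow> (\<exists>C>0. ((\<lambda>q. a q / b q) \<longlongrightarrow> C) (at_right 0))"

text \<open>
  Coefficientwise comparison of two families of polynomials of the form
  sum of a(j) E^j over j = 0, ..., M; the degree bounds express that the families have this form.
\<close>

definition poly_asymp_sim :: "nat \<Rightarrow> (real \<Rightarrow> real poly) \<Rightarrow> (real \<Rightarrow> real poly) \<Rightarrow> bool" where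
  "poly_asymp_sim M a b \<longleftrightarrow>
     (\<forall>q. 0 < q \<and> q < 1 \<longrightarrow> degree (a q) \<le> M \<and> degree (b q) \<le> M) \<and>
     (\<forall>j\<le>M. asymp_sim (\<lambda>q. coeff (a q) j) (\<lambda>q. coeff (b q) j))"

end

theory Submission imports Defs begin

text \<open>
  Dividing the recurrence by \<open>D\<close> gives \<open>c n = (v n + u n E) c (n - 1) - w n c (n - 2)\<close>, so the
  coefficient of \<open>E ^ j\<close> in \<open>c n\<close> is the sum over \<open>m\<close> of \<open>(-1) ^ m\<close> times a sum of products of
  weights, one for each tiling with \<open>m\<close> dimers. For small \<open>q\<close> the weights are positive and
  asymptotic to powers of \<open>q\<close>, so nothing cancels for fixed \<open>m\<close>, and the hypothesis on
  \<open>l1 - l2 - \<beta>\<close> ensures that different \<open>m\<close> give different leading exponents. The comparison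
  polynomial satisfies the same recurrence with \<open>w n\<close> set to \<open>0\<close> whenever \<open>n\<close> and \<open>N\<close> have the
  same parity; this removes some of the dominant tilings, but never all of them, hence preserves
  both the leading exponent and the sign \<open>(-1) ^ m\<close>.
\<close>

section \<open>Continuants and their expansion over tilings\<close>

text \<open>This is the determinant of a tridiagonal matrix with diagonal entries
  \<open>v i + u i * E\<close> whose opposite off-diagonal entries have products \<open>w i\<close>.
  The guard \<open>n = 0\<close> encodes the initial value 0 at index -1.\<close>

fun jacobi_poly :: "(nat \<Rightarrow> real) \<Rightarrow> (nat \<Rightarrow> real) \<Rightarrow> (nat \<Rightarrow> real) \<Rightarrow> nat \<Rightarrow> real poly" where
  "jacobi_poly u v w 0 = 1"
| "jacobi_poly u v w (Suc n) =
     [:v (Suc n), u (Suc n):] * jacobi_poly u v w n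
     - (if n = 0 then 0 else smult (w (Suc n)) (jacobi_poly u v w (n - 1)))"

text \<open>
  Total weight of the tilings of \<open>{1..n}\<close> by \<open>j\<close> marked cells, \<open>m\<close> dimers and unmarked cells,
  where a marked cell \<open>i\<close> has weight \<open>u i\<close>, an unmarked one \<open>v i\<close>, and a dimer
  \<open>{i - 1, i}\<close> has weight \<open>w i\<close>.
\<close>

fun tiling_weight ::
  "(nat \<Rightarrow> real) \<Rightarrow> (nat \<Rightarrow> real) \<Rightarrow> (nat \<Rightarrow> real) \<Rightarrow> nat \<Rightarrow> nat \<Rightarrow> nat \<Rightarrow> real" where
  "tiling_weight u v w 0 j m = (if j = 0 \<and> m = 0 then 1 else 0)"
| "tiling_weight u v w (Suc n) j m =
     v (Suc n) * tiling_weight u v w n j m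
     + (if j = 0 then 0 else u (Suc n) * tiling_weight u v w n (j - 1) m)
     + (if n = 0 \<or> m = 0 then 0 else w (Suc n) * tiling_weight u v w (n - 1) j (m - 1))"

lemma tiling_weight_eq_0: "n < j + 2 * m \<Longrightarrow> tiling_weight u v w n j m = 0"
proof (induction n arbitrary: j m rule: less_induct)
  case (less n)
  show ?case
  proof (cases n)
    case 0
    then show ?thesis using less.prems by auto
  next
    case (Suc k)
    have "tiling_weight u v w k j m = 0"
      using Suc less.prems by (intro less.IH) auto
    moreover have "j = 0 \<or> tiling_weight u v w k (j - 1) m = 0"
      using Suc less.prems by (cases "j = 0") (auto intro!: less.IH)
    moreover have "k = 0 \<or> m = 0 \<or> tiling_weight u v w (k - 1) j (m - 1) = 0"
      using Suc less.prems by (cases "k = 0"; cases "m = 0") (auto intro!: less.IH)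
    ultimately show ?thesis using Suc by auto
  qed
qed

lemma coeff_linear_mult:
  "coeff ([:a, b:] * p) j = a * coeff p j + (if j = 0 then 0 else b * coeff p (j - 1))"
  for a b :: "'a::comm_semiring_0"
  by (cases j) auto

text \<open>Case distinction on the top cell, each dimer contributing a factor -1. A bound
  \<open>M\<close> independent of \<open>n\<close> gives all sums in the recurrence one common
  range.\<close>

lemma coeff_jacobi_poly:
  "n \<le> M \<Longrightarrow> coeff (jacobi_poly u v w n) j = (\<Sum>m\<le>M. (-1) ^ m * tiling_weight u v w n j m)"
proof (induction n arbitrary: j rule: less_induct)
  case (less n)
  let ?T = "tiling_weight u v w"
  show ?case
  proof (cases n)
    case 0
    have "(\<Sum>m\<le>M. (-1) ^ m * ?T 0 j m) = (\<Sum>m\<le>M. if m = 0 then (if j = 0 then 1 else 0) else 0)"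
      by (intro sum.cong) auto
    also have "\<dots> = coeff (jacobi_poly u v w 0) j"
      by (simp add: sum.delta)
    finally show ?thesis using 0 by simp
  next
    case (Suc k)
    \<comment> \<open>Removing the top dimer lowers \<open>m\<close> by 1; the index shift produces
      the minus sign.\<close>
    have dimer: "(\<Sum>m\<le>M. (-1) ^ m * (if m = 0 then 0 else w n * ?T (k - 1) j (m - 1)))
        = - (w n * coeff (jacobi_poly u v w (k - 1)) j)"
    proof -
      obtain M' where M': "M = Suc M'" using Suc less.prems by (cases M) auto
      have "(\<Sum>m\<le>M. (-1) ^ m * (if m = 0 then 0 else w n * ?T (k - 1) j (m - 1)))
          = (\<Sum>m\<le>M'. (-1) ^ Suc m * (w n * ?T (k - 1) j m))"
        unfolding M' by (subst sum.atMost_Suc_shift) simp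
      also have "\<dots> = - (w n * (\<Sum>m\<le>M'. (-1) ^ m * ?T (k - 1) j m))"
        by (simp add: sum_distrib_left sum_negf algebra_simps)
      \<comment> \<open>The added term would place \<open>M\<close> dimers on
        \<open>k - 1 < M\<close> cells, so it is 0.\<close>
      also have "(\<Sum>m\<le>M'. (-1) ^ m * ?T (k - 1) j m) = (\<Sum>m\<le>M. (-1) ^ m * ?T (k - 1) j m)"
        using Suc less.prems by (simp add: M' tiling_weight_eq_0)
      also have "\<dots> = coeff (jacobi_poly u v w (k - 1)) j"
        using Suc less.prems by (intro less.IH[symmetric]) auto
      finally show ?thesis .
    qed
    have IH: "coeff (jacobi_poly u v w k) i = (\<Sum>m\<le>M. (-1) ^ m * ?T k i m)" for i
      using Suc less.prems by (intro less.IH) auto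
    have "(\<Sum>m\<le>M. (-1) ^ m * ?T n j m) =
        v n * (\<Sum>m\<le>M. (-1) ^ m * ?T k j m)
        + (if j = 0 then 0 else u n * (\<Sum>m\<le>M. (-1) ^ m * ?T k (j - 1) m))
        + (if k = 0 then 0 else
            (\<Sum>m\<le>M. (-1) ^ m * (if m = 0 then 0 else w n * ?T (k - 1) j (m - 1))))"
      unfolding Suc sum_distrib_left
      by (auto simp: sum.distrib[symmetric] algebra_simps intro!: sum.cong)
    then show ?thesis
      unfolding IH[symmetric] dimer using Suc by (auto simp: coeff_linear_mult simp del: mult_pCons_left)
  qed
qed

lemma degree_jacobi_poly: "degree (jacobi_poly u v w n) \<le> n"
  by (rule degree_le)
    (auto simp: coeff_jacobi_poly[of n n] tiling_weight_eq_0)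

section \<open>Leading exponents of tiling sums\<close>

text \<open>
  A tiling of maximal weight as \<open>q \<rightarrow> 0\<close> covers the topmost \<open>j + 2 * m\<close> cells by its marked cells
  and dimers; the order of these does not affect the exponent.
\<close>

definition tiling_exponent :: "real \<Rightarrow> real \<Rightarrow> real \<Rightarrow> nat \<Rightarrow> nat \<Rightarrow> nat \<Rightarrow> real" where
  "tiling_exponent a b g n j m =
     (let k = real j + 2 * real m in
      real n * (real n + 1 + a) - k * real n + k * (k - 1) / 2
      - real j * (1 + a - g) - real m * (2 * a - b))"

lemma powr_tendsto_0_at_right: "0 < r \<Longrightarrow> ((\<lambda>q::real. q powr r) \<longlongrightarrow> 0) (at_right 0)"
  by (rule tendsto_zero_powrI[where b = r])
    (auto intro!: tendsto_eq_intros simp: eventually_at_filter)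

text \<open>The surplus factor \<open>q powr (s - r)\<close> tends to 0 unless \<open>r = s\<close>.
  This allows terms of different orders to be measured against one common power.\<close>

lemma tendsto_divide_powr_transfer:
  fixes f :: "real \<Rightarrow> real"
  assumes "((\<lambda>q. f q / q powr s) \<longlongrightarrow> L) (at_right 0)" and "r \<le> s"
  shows "((\<lambda>q. f q / q powr r) \<longlongrightarrow> (if r = s then L else 0)) (at_right 0)"
proof (cases "r = s")
  case True
  then show ?thesis using assms by simp
next
  case False
  have "((\<lambda>q. (f q / q powr s) * q powr (s - r)) \<longlongrightarrow> L * 0) (at_right 0)"
    using assms False by (intro tendsto_mult powr_tendsto_0_at_right) auto
  moreover have "\<forall>\<^sub>F q in at_right 0. (f q / q powr s) * q powr (s - r) = f q / q powr r"
    using eventually_at_right_less[of "0::real"] by eventually_elim (simp add: powr_diff)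
  ultimately show ?thesis using False by (auto elim: Lim_transform_eventually)
qed

lemma tendsto_mult_divide_powr:
  fixes f1 f2 :: "real \<Rightarrow> real"
  assumes "((\<lambda>q. f1 q / q powr r1) \<longlongrightarrow> L1) (at_right 0)"
    and "((\<lambda>q. f2 q / q powr r2) \<longlongrightarrow> L2) (at_right 0)" and "r = r1 + r2"
  shows "((\<lambda>q. f1 q * f2 q / q powr r) \<longlongrightarrow> L1 * L2) (at_right 0)"
  using tendsto_mult[OF assms(1,2)] by (simp add: assms(3) powr_add)

text \<open>All limits are nonnegative, so one optimal tiling of positive weight suffices. If
  \<open>n\<close> has the parity of \<open>M\<close>, the dimers can be stacked at the top on {n-1,
  n}, {n-3, n-2} and so on, where \<open>W'\<close> makes their weights positive. Below them only
  single cells remain, at either parity; hence the alternative \<open>m = 0\<close>.\<close>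

lemma tiling_weight_tendsto:
  fixes u v w :: "real \<Rightarrow> nat \<Rightarrow> real" and U V W :: "nat \<Rightarrow> real"
  assumes u: "\<And>n. 1 \<le> n \<Longrightarrow> n \<le> M \<Longrightarrow>
      ((\<lambda>q. u q n / q powr (real n - 1 + g)) \<longlongrightarrow> U n) (at_right 0)"
    and v: "\<And>n. 1 \<le> n \<Longrightarrow> n \<le> M \<Longrightarrow>
      ((\<lambda>q. v q n / q powr (2 * real n + a)) \<longlongrightarrow> V n) (at_right 0)"
    and w: "\<And>n. 2 \<le> n \<Longrightarrow> n \<le> M \<Longrightarrow>
      ((\<lambda>q. w q n / q powr (2 * real n - 1 + b)) \<longlongrightarrow> W n) (at_right 0)"
    and U: "\<And>n. 1 \<le> n \<Longrightarrow> n \<le> M \<Longrightarrow> U n > 0"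
    and V: "\<And>n. 1 \<le> n \<Longrightarrow> n \<le> M \<Longrightarrow> V n > 0"
    and W: "\<And>n. 2 \<le> n \<Longrightarrow> n \<le> M \<Longrightarrow> W n \<ge> 0"
    and W': "\<And>n. 2 \<le> n \<Longrightarrow> n \<le> M \<Longrightarrow> even (M + n) \<Longrightarrow> W n > 0"
    and "n \<le> M"
  shows "\<exists>K\<ge>0. (j + 2 * m \<le> n \<longrightarrow> m = 0 \<or> even (M + n) \<longrightarrow> K > 0) \<and>
    ((\<lambda>q. tiling_weight (u q) (v q) (w q) n j m / q powr tiling_exponent a b g n j m) \<longlongrightarrow> K)
      (at_right 0)"
  using \<open>n \<le> M\<close>
proof (induction n arbitrary: j m rule: less_induct)
  case (less n)
  let ?T = "\<lambda>n j m q. tiling_weight (u q) (v q) (w q) n j m"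
  let ?e = "tiling_exponent a b g"
  show ?case
  proof (cases n)
    case 0
    let ?L = "if j = 0 \<and> m = 0 then 1 else 0 :: real"
    have "\<forall>\<^sub>F q in at_right (0::real). ?T 0 j m q / q powr ?e 0 j m = ?L"
      using eventually_at_right_less[of "0::real"]
      by eventually_elim (simp add: tiling_exponent_def)
    then have "((\<lambda>q. ?T 0 j m q / q powr ?e 0 j m) \<longlongrightarrow> ?L) (at_right 0)"
      by (rule tendsto_eventually)
    then show ?thesis using 0 by (intro exI[of _ ?L]) auto
  next
    case (Suc k)
    have n: "1 \<le> n" "n \<le> M" "k < n" "k \<le> M" using Suc less.prems by auto
    obtain K1 where K1: "K1 \<ge> 0" "j + 2 * m \<le> k \<Longrightarrow> m = 0 \<Longrightarrow> K1 > 0"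
      "((\<lambda>q. ?T k j m q / q powr ?e k j m) \<longlongrightarrow> K1) (at_right 0)"
      using less.IH[OF n(3,4), of j m] by blast
    \<comment> \<open>An unmarked cell on top exceeds the optimal exponent by
      \<open>j + 2 * m\<close>, so it survives only for \<open>j = m = 0\<close>.\<close>
    define L1 where "L1 = (if j + 2 * m = 0 then V n * K1 else 0)"
    have "((\<lambda>q. v q n * ?T k j m q / q powr (2 * real n + a + ?e k j m)) \<longlongrightarrow> V n * K1) (at_right 0)"
      by (rule tendsto_mult_divide_powr[OF v[OF n(1,2)] K1(3) refl])
    moreover have "?e n j m = 2 * real n + a + ?e k j m - (real j + 2 * real m)"
      by (simp add: Suc tiling_exponent_def Let_def algebra_simps)
    ultimately have T1: "((\<lambda>q. v q n * ?T k j m q / q powr ?e n j m) \<longlongrightarrow> L1) (at_right 0)"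
      using tendsto_divide_powr_transfer[of "\<lambda>q. v q n * ?T k j m q" _ "V n * K1" "?e n j m"]
      by (fastforce simp: L1_def)
    have L1: "L1 \<ge> 0" "j = 0 \<Longrightarrow> m = 0 \<Longrightarrow> L1 > 0"
      using K1 V[OF n(1,2)] by (auto simp: L1_def)
    obtain L2 where L2: "L2 \<ge> 0" "j + 2 * m \<le> n \<Longrightarrow> m = 0 \<Longrightarrow> j \<noteq> 0 \<Longrightarrow> L2 > 0"
      "((\<lambda>q. (if j = 0 then 0 else u q n * ?T k (j - 1) m q) / q powr ?e n j m) \<longlongrightarrow> L2) (at_right 0)"
    proof (cases "j = 0")
      case True
      then show ?thesis using that[of 0] by simp
    next
      case False
      obtain K2 where K2: "K2 \<ge> 0" "j - 1 + 2 * m \<le> k \<Longrightarrow> m = 0 \<Longrightarrow> K2 > 0"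
        "((\<lambda>q. ?T k (j - 1) m q / q powr ?e k (j - 1) m) \<longlongrightarrow> K2) (at_right 0)"
        using less.IH[OF n(3,4), of "j - 1" m] by blast
      \<comment> \<open>The exponents \<open>n - 1 + g\<close> and, for a dimer,
        \<open>(n - 1) + n + b\<close> are sums of covered positions plus constants. Hence removing
        a marked cell or a dimer from the top loses nothing.\<close>
      have "?e n j m = real n - 1 + g + ?e k (j - 1) m"
        using False by (simp add: Suc tiling_exponent_def Let_def of_nat_diff field_simps)
      from tendsto_mult_divide_powr[OF u[OF n(1,2)] K2(3) this] show ?thesis
        using that[of "U n * K2"] U[OF n(1,2)] K2(1,2) False Suc by auto
    qed
    obtain L3 where L3: "L3 \<ge> 0" "j + 2 * m \<le> n \<Longrightarrow> m \<noteq> 0 \<Longrightarrow> even (M + n) \<Longrightarrow> L3 > 0"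
      "((\<lambda>q. (if k = 0 \<or> m = 0 then 0 else w q n * ?T (k - 1) j (m - 1) q) / q powr ?e n j m)
         \<longlongrightarrow> L3) (at_right 0)"
    proof (cases "k = 0 \<or> m = 0")
      case True
      then show ?thesis using that[of 0] Suc by auto
    next
      case False
      then have n': "2 \<le> n" "k - 1 < n" "k - 1 \<le> M" using Suc n by auto
      obtain K3 where K3: "K3 \<ge> 0"
        "j + 2 * (m - 1) \<le> k - 1 \<Longrightarrow> even (M + (k - 1)) \<Longrightarrow> K3 > 0"
        "((\<lambda>q. ?T (k - 1) j (m - 1) q / q powr ?e (k - 1) j (m - 1)) \<longlongrightarrow> K3) (at_right 0)"
        using less.IH[OF n'(2,3), of j "m - 1"] by blast
      have "?e n j m = 2 * real n - 1 + b + ?e (k - 1) j (m - 1)"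
        using False by (simp add: Suc tiling_exponent_def Let_def of_nat_diff field_simps)
      from tendsto_mult_divide_powr[OF w[OF n'(1) n(2)] K3(3) this]
      show ?thesis
        using that[of "W n * K3"] W[OF n'(1) n(2)] W'[OF n'(1) n(2)] K3(1,2) False Suc
        by auto
    qed
    have "((\<lambda>q. ?T n j m q / q powr ?e n j m) \<longlongrightarrow> L1 + L2 + L3) (at_right 0)"
      using tendsto_add[OF tendsto_add[OF T1 L2(3)] L3(3)]
      unfolding Suc by (simp add: add_divide_distrib)
    \<comment> \<open>The positive summand is \<open>L3\<close> for \<open>m > 0\<close>,
      \<open>L2\<close> for \<open>m = 0 < j\<close>, and \<open>L1\<close> for
      \<open>j = m = 0\<close>.\<close>
    moreover have "L1 + L2 + L3 > 0" if "j + 2 * m \<le> n" "m = 0 \<or> even (M + n)"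
      using L1 L2(1,2) L3(1,2) that by (cases "m = 0"; cases "j = 0") (auto simp: add_pos_nonneg add_nonneg_pos)
    ultimately show ?thesis using L1 L2(1) L3(1) by (intro exI[of _ "L1 + L2 + L3"]) auto
  qed
qed

text \<open>The dimer number with strictly least exponent dictates order and sign. At
  \<open>n = M\<close> the parity condition reads \<open>even (M + M)\<close>, so the limit stays
  positive even if alternate dimers are missing.\<close>

lemma coeff_jacobi_poly_tendsto:
  fixes u v w :: "real \<Rightarrow> nat \<Rightarrow> real" and U V W :: "nat \<Rightarrow> real"
  assumes u: "\<And>n. 1 \<le> n \<Longrightarrow> n \<le> M \<Longrightarrow>
      ((\<lambda>q. u q n / q powr (real n - 1 + g)) \<longlongrightarrow> U n) (at_right 0)"
    and v: "\<And>n. 1 \<le> n \<Longrightarrow> n \<le> M \<Longrightarrow>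
      ((\<lambda>q. v q n / q powr (2 * real n + a)) \<longlongrightarrow> V n) (at_right 0)"
    and w: "\<And>n. 2 \<le> n \<Longrightarrow> n \<le> M \<Longrightarrow>
      ((\<lambda>q. w q n / q powr (2 * real n - 1 + b)) \<longlongrightarrow> W n) (at_right 0)"
    and U: "\<And>n. 1 \<le> n \<Longrightarrow> n \<le> M \<Longrightarrow> U n > 0"
    and V: "\<And>n. 1 \<le> n \<Longrightarrow> n \<le> M \<Longrightarrow> V n > 0"
    and W: "\<And>n. 2 \<le> n \<Longrightarrow> n \<le> M \<Longrightarrow> W n \<ge> 0"
    and W': "\<And>n. 2 \<le> n \<Longrightarrow> n \<le> M \<Longrightarrow> even (M + n) \<Longrightarrow> W n > 0"
    and m: "j + 2 * m \<le> M"
    and min: "\<And>i. j + 2 * i \<le> M \<Longrightarrow> i \<noteq> m \<Longrightarrow>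
      tiling_exponent a b g M j m < tiling_exponent a b g M j i"
  obtains K where "K > 0"
    "((\<lambda>q. coeff (jacobi_poly (u q) (v q) (w q) M) j / q powr tiling_exponent a b g M j m)
       \<longlongrightarrow> (-1) ^ m * K) (at_right 0)"
proof -
  let ?T = "\<lambda>i q. tiling_weight (u q) (v q) (w q) M j i"
  let ?e = "tiling_exponent a b g M j"
  have lim: "\<exists>K\<ge>0. (j + 2 * i \<le> M \<longrightarrow> i = 0 \<or> even (M + M) \<longrightarrow> K > 0) \<and>
      ((\<lambda>q. ?T i q / q powr ?e i) \<longlongrightarrow> K) (at_right 0)" for i
    by (rule tiling_weight_tendsto[where M = M, OF u v w U V W W']) (assumption | simp)+
  obtain K where K0: "j + 2 * m \<le> M \<longrightarrow> m = 0 \<or> even (M + M) \<longrightarrow> K > 0"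
    and K: "((\<lambda>q. ?T m q / q powr ?e m) \<longlongrightarrow> K) (at_right 0)"
    using lim[of m] by blast
  have "K > 0" using K0 m by simp
  \<comment> \<open>Other feasible \<open>i\<close> are negligible by \<open>min\<close>; infeasible
    \<open>i\<close> have weight 0.\<close>
  have "((\<lambda>q. ?T i q / q powr ?e m) \<longlongrightarrow> (if i = m then K else 0)) (at_right 0)" for i
  proof (cases "i = m \<or> M < j + 2 * i")
    case True
    then show ?thesis using K m by (auto simp: tiling_weight_eq_0)
  next
    case False
    obtain K' where K': "((\<lambda>q. ?T i q / q powr ?e i) \<longlongrightarrow> K') (at_right 0)"
      using lim[of i] by blast
    from tendsto_divide_powr_transfer[OF K', of "?e m"] show ?thesis
      using min[of i] False by auto
  qed
  then have "((\<lambda>q. \<Sum>i\<le>M. (-1) ^ i * (?T i q / q powr ?e m))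
      \<longlongrightarrow> (\<Sum>i\<le>M. (-1) ^ i * (if i = m then K else 0))) (at_right 0)"
    by (intro tendsto_intros)
  moreover have "(\<Sum>i\<le>M. (-1) ^ i * (if i = m then K else 0)) = (-1) ^ m * K"
    using m by (simp add: if_distrib[of "\<lambda>x. _ * x"] sum.delta cong: if_cong)
  ultimately show thesis
    using that[OF \<open>K > 0\<close>] by (simp add: coeff_jacobi_poly[OF order_refl] sum_divide_distrib)
qed

section \<open>Uniqueness of the leading exponent\<close>

text \<open>For fixed \<open>j\<close> the exponent is quadratic in \<open>m\<close>, which yields
  the factor \<open>m - i\<close>; two different dimer numbers tie exactly when the other factor
  vanishes.\<close>

lemma tiling_exponent_diff:
  "tiling_exponent a b g M j i - tiling_exponent a b g M j m
     = (real m - real i) * (2 * (real M - real j - real i - real m) + (2 * a - b + 1))"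
  by (simp add: tiling_exponent_def Let_def field_simps)

lemma tiling_exponent_unique_min:
  assumes nores: "\<And>k. 1 \<le> k \<Longrightarrow> k < M \<Longrightarrow> 2 * a - b + 1 \<noteq> - 2 * real k" and "j \<le> M"
  obtains m where "j + 2 * m \<le> M"
    "\<And>i. j + 2 * i \<le> M \<Longrightarrow> i \<noteq> m \<Longrightarrow> tiling_exponent a b g M j m < tiling_exponent a b g M j i"
proof -
  let ?e = "tiling_exponent a b g M j"
  let ?S = "{m. j + 2 * m \<le> M}"
  have neq: "?e i \<noteq> ?e m" if "j + 2 * m \<le> M" "i < m" for i m
  proof
    assume "?e i = ?e m"
    then have "2 * a - b + 1 = - 2 * (real M - real j - real i - real m)"
      using tiling_exponent_diff[of a b g M j i m] that by simp
    also have "\<dots> = - 2 * real (M - j - i - m)"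
      using that by simp
    \<comment> \<open>From \<open>i < m\<close> and \<open>j + 2 * m \<le> M\<close>, this number
      lies between 1 and \<open>M - 1\<close>.\<close>
    finally show False using nores[of "M - j - i - m"] that by linarith
  qed
  have fin: "finite ?S" by (rule finite_subset[of _ "{..M}"]) auto
  have ne: "?S \<noteq> {}" using \<open>j \<le> M\<close> by (auto intro: exI[of _ 0])
  obtain m where m: "m \<in> ?S" "\<And>i. i \<in> ?S \<Longrightarrow> ?e m \<le> ?e i"
    using ex_is_arg_min_if_finite[OF fin ne, of ?e] unfolding is_arg_min_linorder by blast
  show thesis
  proof (rule that[of m])
    fix i assume i: "j + 2 * i \<le> M" "i \<noteq> m"
    have "j + 2 * m \<le> M" using m(1) by simp
    then have "?e i \<noteq> ?e m"
      using neq[of m i] neq[of i m] i by (metis linorder_neqE_nat)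
    moreover have "?e m \<le> ?e i" using m(2) i(1) by simp
    ultimately show "?e m < ?e i" by linarith
  qed (use m(1) in simp)
qed

section \<open>Both polynomials as continuants\<close>

text \<open>No dimer joins cells \<open>n\<close> and \<open>Suc n\<close>, so the top two cells
  split off as a 2 x 2 determinant.\<close>

lemma jacobi_poly_alternating_step:
  assumes "w (Suc n) = 0"
  shows "jacobi_poly u v w (Suc (Suc n)) =
     ([:v (Suc (Suc n)), u (Suc (Suc n)):] * [:v (Suc n), u (Suc n):] - [:w (Suc (Suc n)):])
     * jacobi_poly u v w n"
proof -
  have "jacobi_poly u v w (Suc n) = [:v (Suc n), u (Suc n):] * jacobi_poly u v w n"
    using assms by simp
  moreover have "jacobi_poly u v w (Suc (Suc n)) =
      [:v (Suc (Suc n)), u (Suc (Suc n)):] * jacobi_poly u v w (Suc n)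
      - [:w (Suc (Suc n)):] * jacobi_poly u v w n"
    by (subst jacobi_poly.simps(2)) simp
  ultimately show ?thesis
    by (simp only: left_diff_distrib mult.assoc)
qed

text \<open>The offset \<open>s\<close> counts the cells below all pairs; it is 0 or 1 in the
  application, according to the parity of \<open>N\<close>.\<close>

lemma prod_pairs_eq_jacobi_poly:
  fixes u v w :: "nat \<Rightarrow> real"
  assumes "\<And>n. odd n \<Longrightarrow> w (s + n) = 0"
    and p: "\<And>n. 2 \<le> n \<Longrightarrow> even n \<Longrightarrow>
      p (s + n) = [:v (s + n), u (s + n):] * [:v (s + n - 1), u (s + n - 1):] - [:w (s + n):]"
  shows "jacobi_poly u v w s * (\<Prod>n = 1..k. p (s + 2 * n)) = jacobi_poly u v w (s + 2 * k)"
proof (induction k)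
  case (Suc k)
  have "w (Suc (s + 2 * k)) = 0" using assms(1)[of "Suc (2 * k)"] by simp
  then have "jacobi_poly u v w (s + 2 * Suc k) = p (s + 2 * Suc k) * jacobi_poly u v w (s + 2 * k)"
    using p[of "2 * Suc k"] jacobi_poly_alternating_step[where n = "s + 2 * k"]
    by (simp del: jacobi_poly.simps)
  then show ?case unfolding Suc.IH[symmetric] by (simp add: mult_ac)
qed simp

text \<open>Only the dimers {N, N+1}, {N-2, N-1}, ... are kept, and each \<open>heun_p\<close> is
  the determinant of one such pair. For even \<open>N\<close>, the leftover cell 1 is the linear
  factor.\<close>

lemma heun_c_tilde_eq_jacobi_poly:
  "heun_c_tilde h1 h2 l1 l2 \<alpha>1 \<alpha>2 \<beta> q N =
    jacobi_poly (\<lambda>n. q powr (real n - 1 + (heun_lambda h1 h2 l1 l2 \<alpha>1 \<alpha>2 \<beta> - h1 - h2)))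
      (\<lambda>n. q powr (2 * real n + (- 1/2 - l2 - \<beta>)))
      (\<lambda>n. if even (N + 1 + n) then q powr (2 * real n - 1 + (- l1 - l2 - \<beta>)) else 0) (N + 1)"
    (is "_ = jacobi_poly ?u ?v ?w _")
proof -
  have p: "heun_p h1 h2 l1 l2 \<alpha>1 \<alpha>2 \<beta> q n = [:?v n, ?u n:] * [:?v (n - 1), ?u (n - 1):] - [:?w n:]"
    if "2 \<le> n" "even (N + 1 + n)" for n
    using that by (simp add: heun_p_def Let_def of_nat_diff algebra_simps)
  show ?thesis
  proof (cases "odd N")
    case True
    then obtain k where k: "N + 1 = 2 * k" by (metis evenE even_plus_one_iff)
    have "jacobi_poly ?u ?v ?w 0 * (\<Prod>n = 1..k. heun_p h1 h2 l1 l2 \<alpha>1 \<alpha>2 \<beta> q (0 + 2 * n))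
        = jacobi_poly ?u ?v ?w (0 + 2 * k)"
      using True by (intro prod_pairs_eq_jacobi_poly) (simp, subst p, auto)
    then show ?thesis using True k by (simp add: heun_c_tilde_def)
  next
    case False
    then obtain k where k: "N = 2 * k" by (auto elim: evenE)
    have "jacobi_poly ?u ?v ?w 1 * (\<Prod>n = 1..k. heun_p h1 h2 l1 l2 \<alpha>1 \<alpha>2 \<beta> q (1 + 2 * n))
        = jacobi_poly ?u ?v ?w (1 + 2 * k)"
      using False by (intro prod_pairs_eq_jacobi_poly) (simp, subst p, auto)
    moreover have "jacobi_poly ?u ?v ?w 1 =
        [: q powr (3/2 - l2 - \<beta>), q powr (heun_lambda h1 h2 l1 l2 \<alpha>1 \<alpha>2 \<beta> - h1 - h2) :]"
      by (simp add: add_diff_eq)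
    ultimately show ?thesis using k by (simp add: heun_c_tilde_def add.commute)
  qed
qed

lemma heun_c_eq_jacobi_poly:
  "heun_c h1 h2 l1 l2 \<alpha>1 \<alpha>2 \<beta> t1 t2 q n =
    jacobi_poly (\<lambda>n. coeff (heun_A h1 h2 l1 l2 \<alpha>1 \<alpha>2 \<beta> t1 t2 q n) 1 / heun_D h1 h2 \<beta> t1 t2 q n)
      (\<lambda>n. coeff (heun_A h1 h2 l1 l2 \<alpha>1 \<alpha>2 \<beta> t1 t2 q n) 0 / heun_D h1 h2 \<beta> t1 t2 q n)
      (\<lambda>n. heun_B h1 h2 l1 l2 \<alpha>1 \<alpha>2 \<beta> q n / heun_D h1 h2 \<beta> t1 t2 q n) n"
  (is "?c n = jacobi_poly ?u ?v ?w n")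
proof (induction n rule: less_induct)
  case (less n)
  let ?A = "heun_A h1 h2 l1 l2 \<alpha>1 \<alpha>2 \<beta> t1 t2 q" and ?D = "heun_D h1 h2 \<beta> t1 t2 q"
  have A: "smult (1 / ?D n) (?A n) = [:?v n, ?u n:]" for n
    by (simp add: heun_A_def Let_def)
  consider "n = 0" | "n = Suc 0" | k where "n = Suc (Suc k)"
    by (metis not0_implies_Suc)
  then show ?case
  proof cases
    case 2
    then show ?thesis using A[of 1] by simp
  next
    case 3
    have "?c n = smult (1 / ?D n) (?A n) * ?c (Suc k) - smult (?w n) (?c k)"
      by (simp add: 3 smult_diff_right mult.commute)
    then show ?thesis
      using less.IH[of k] less.IH[of "Suc k"] 3 by (simp only: A) simp
  qed simp
qed

section \<open>Asymptotics of the q-Heun recurrence coefficients\<close>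

lemma tendsto_divide_divide_powr:
  fixes f1 f2 :: "real \<Rightarrow> real"
  assumes "((\<lambda>q. f1 q / q powr r1) \<longlongrightarrow> L1) (at_right 0)"
    and "((\<lambda>q. f2 q / q powr r2) \<longlongrightarrow> L2) (at_right 0)" and "L2 \<noteq> 0" and "r = r1 - r2"
  shows "((\<lambda>q. f1 q / f2 q / q powr r) \<longlongrightarrow> L1 / L2) (at_right 0)"
proof -
  have "(f1 q / q powr r1) / (f2 q / q powr r2) = f1 q / f2 q / q powr r" for q
    by (simp add: assms(4) powr_diff)
  then show ?thesis using tendsto_divide[OF assms(1,2,3)] by simp
qed

lemma monomial_divide_powr_tendsto:
  "r \<le> s \<Longrightarrow> ((\<lambda>q::real. c * q powr s / q powr r) \<longlongrightarrow> (if r = s then c else 0)) (at_right 0)"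
  by (rule tendsto_divide_powr_transfer[OF tendsto_eventually[OF
        eventually_mono[OF eventually_at_right_less]]]) auto

lemma one_minus_powr_tendsto:
  assumes "s < 0"
  shows "((\<lambda>q::real. (1 - q powr s) / q powr s) \<longlongrightarrow> -1) (at_right 0)"
proof -
  have "((\<lambda>q::real. q powr (- s) - 1) \<longlongrightarrow> 0 - 1) (at_right 0)"
    using assms by (intro tendsto_diff powr_tendsto_0_at_right) auto
  moreover have "\<forall>\<^sub>F q in at_right (0::real). q powr (- s) - 1 = (1 - q powr s) / q powr s"
    using eventually_at_right_less[of "0::real"]
    by eventually_elim (simp add: powr_minus field_simps)
  ultimately show ?thesis by (auto elim: Lim_transform_eventually)
qed

lemma heun_D_tendsto:
  assumes "\<beta> < 1" "1 \<le> n"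
  shows "((\<lambda>q. heun_D h1 h2 \<beta> t1 t2 q n / q powr (h1 + h2)) \<longlongrightarrow> t1 * t2) (at_right 0)"
proof -
  have "((\<lambda>q::real. t1 * t2 * (1 - q ^ n) * (1 - q powr (real n - \<beta>)))
      \<longlongrightarrow> t1 * t2 * (1 - 0 ^ n) * (1 - 0)) (at_right 0)"
    using assms by (intro tendsto_intros powr_tendsto_0_at_right) auto
  moreover have "\<forall>\<^sub>F q in at_right (0::real). t1 * t2 * (1 - q ^ n) * (1 - q powr (real n - \<beta>))
      = heun_D h1 h2 \<beta> t1 t2 q n / q powr (h1 + h2)"
    using eventually_at_right_less[of "0::real"] by eventually_elim (simp add: heun_D_def)
  ultimately show ?thesis using assms by (auto simp: power_0_left elim: Lim_transform_eventually)
qed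

text \<open>Of the four monomials, \<open>q powr (l1 + X)\<close> has the least exponent:
  \<open>l1 < l2\<close> beats the fourth, the first hypothesis beats the first, and with
  \<open>h1 < h2\<close> also the second.\<close>

lemma heun_A_coeff_0_tendsto:
  assumes "2 * real n - 1 + h2 - l2 - \<beta> < 0" "h1 < h2" "l1 < l2"
  shows "((\<lambda>q. coeff (heun_A h1 h2 l1 l2 \<alpha>1 \<alpha>2 \<beta> t1 t2 q n) 0
            / q powr (2 * real n + (- 1/2 - l2 - \<beta>) + (h1 + h2))) \<longlongrightarrow> t1) (at_right 0)"
proof -
  let ?r = "2 * real n + (- 1/2 - l2 - \<beta>) + (h1 + h2)"
  define X where "X = 2 * (real n + heun_lambda h1 h2 l1 l2 \<alpha>1 \<alpha>2 \<beta>) + \<alpha>1 + \<alpha>2 - 5/2"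
  have r: "l1 + X = ?r" "l2 + X > ?r"
    using assms by (auto simp: X_def heun_lambda_def field_simps)
  have eq: "coeff (heun_A h1 h2 l1 l2 \<alpha>1 \<alpha>2 \<beta> t1 t2 q n) 0 / q powr ?r =
      t1 * q powr (1/2 + h1) / q powr ?r + t2 * q powr (1/2 + h2) / q powr ?r
      + t1 * q powr (l1 + X) / q powr ?r + t2 * q powr (l2 + X) / q powr ?r" for q
    unfolding heun_A_def Let_def X_def[symmetric]
    by (simp add: powr_add add_divide_distrib[symmetric] algebra_simps)
  have "((\<lambda>q. coeff (heun_A h1 h2 l1 l2 \<alpha>1 \<alpha>2 \<beta> t1 t2 q n) 0 / q powr ?r) \<longlongrightarrow>
      (if ?r = 1/2 + h1 then t1 else 0) + (if ?r = 1/2 + h2 then t2 else 0)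
      + (if ?r = l1 + X then t1 else 0) + (if ?r = l2 + X then t2 else 0)) (at_right 0)"
    unfolding eq using r assms by (intro tendsto_add monomial_divide_powr_tendsto) linarith+
  moreover have "?r \<noteq> 1/2 + h1" "?r \<noteq> 1/2 + h2" "?r \<noteq> l2 + X" "?r = l1 + X"
    using r assms by linarith+
  ultimately show ?thesis by (simp only: if_False if_True simp_thms add_0_left add_0_right)
qed

lemma heun_A_coeff_1_tendsto:
  "((\<lambda>q. coeff (heun_A h1 h2 l1 l2 \<alpha>1 \<alpha>2 \<beta> t1 t2 q n) 1
      / q powr (real n - 1 + heun_lambda h1 h2 l1 l2 \<alpha>1 \<alpha>2 \<beta>)) \<longlongrightarrow> 1) (at_right 0)"
  using monomial_divide_powr_tendsto[of _ _ 1, OF order_refl]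
  by (simp add: heun_A_def Let_def)

text \<open>Both brackets are dominated by a negative power with coefficient -1, and the two signs
  cancel.\<close>

lemma heun_B_tendsto:
  assumes "real n - 2 + heun_lambda h1 h2 l1 l2 \<alpha>1 \<alpha>2 \<beta> + \<alpha>1 < 0"
    and "real n - 2 + heun_lambda h1 h2 l1 l2 \<alpha>1 \<alpha>2 \<beta> + \<alpha>2 < 0"
  shows "((\<lambda>q. heun_B h1 h2 l1 l2 \<alpha>1 \<alpha>2 \<beta> q n
            / q powr (2 * real n - 1 + (- l1 - l2 - \<beta>) + (h1 + h2))) \<longlongrightarrow> 1) (at_right 0)"
proof -
  have "((\<lambda>q::real. q / q powr 1) \<longlongrightarrow> 1) (at_right 0)"
    by (rule tendsto_eventually[OF eventually_mono[OF eventually_at_right_less]]) auto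
  from tendsto_mult_divide_powr[OF
      tendsto_mult_divide_powr[OF this one_minus_powr_tendsto[OF assms(1)] refl]
      one_minus_powr_tendsto[OF assms(2)],
      of "2 * real n - 1 + (- l1 - l2 - \<beta>) + (h1 + h2)"]
  show ?thesis by (simp add: heun_B_def Let_def heun_lambda_def field_simps)
qed

section \<open>Coefficientwise comparison of the two continuants\<close>

theorem theorem3p6:
  fixes h1 h2 l1 l2 \<alpha>1 \<alpha>2 \<beta> t1 t2 :: real and N :: nat
  assumes "real N = - heun_lambda h1 h2 l1 l2 \<alpha>1 \<alpha>2 \<beta> - \<alpha>1"
    and "\<beta> < 1"
    and "\<alpha>2 - \<alpha>1 < 1"
    and "t1 > 0" and "t2 > 0"
    and "h1 < h2" and "l1 < l2"
    and "2 * real N + 1 + h2 - l2 - \<beta> < 0"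
    and "l1 - l2 - \<beta> \<notin> {- 2 * real k | k. 1 \<le> k \<and> k \<le> N}"
  shows "poly_asymp_sim (N + 1)
           (\<lambda>q. heun_c h1 h2 l1 l2 \<alpha>1 \<alpha>2 \<beta> t1 t2 q (N + 1))
           (\<lambda>q. heun_c_tilde h1 h2 l1 l2 \<alpha>1 \<alpha>2 \<beta> q N)"
proof -
  let ?c = "\<lambda>q. heun_c h1 h2 l1 l2 \<alpha>1 \<alpha>2 \<beta> t1 t2 q (N + 1)"
  let ?c' = "\<lambda>q. heun_c_tilde h1 h2 l1 l2 \<alpha>1 \<alpha>2 \<beta> q N"
  let ?\<mu> = "heun_lambda h1 h2 l1 l2 \<alpha>1 \<alpha>2 \<beta>"
  define g where "g = ?\<mu> - h1 - h2"
  define a where "a = - 1/2 - l2 - \<beta>"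
  define b where "b = - l1 - l2 - \<beta>"
  note D = heun_D_tendsto[OF \<open>\<beta> < 1\<close>, of _ h1 h2 t1 t2]
  have t: "t1 * t2 \<noteq> 0" "t1 * t2 > 0" using assms by auto
  have "asymp_sim (\<lambda>q. coeff (?c q) j) (\<lambda>q. coeff (?c' q) j)" if "j \<le> N + 1" for j
  proof -
    \<comment> \<open>The left side equals \<open>l1 - l2 - \<beta>\<close>, so a tie between
      exponents is the excluded resonance.\<close>
    have "2 * a - b + 1 \<noteq> - 2 * real k" if "1 \<le> k" "k < N + 1" for k
      using assms(9) that by (force simp: a_def b_def)
    then obtain m where m: "j + 2 * m \<le> N + 1"
      "\<And>i. j + 2 * i \<le> N + 1 \<Longrightarrow> i \<noteq> m \<Longrightarrow>
        tiling_exponent a b g (N + 1) j m < tiling_exponent a b g (N + 1) j i"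
      using tiling_exponent_unique_min[of "N + 1" a b j g] \<open>j \<le> N + 1\<close> by blast
    \<comment> \<open>The exponent depends only on \<open>a\<close>, \<open>b\<close>,
      \<open>g\<close>, \<open>j\<close>, \<open>m\<close> and \<open>N\<close>, so \<open>m\<close>
      and \<open>?e\<close> serve both polynomials.\<close>
    let ?e = "tiling_exponent a b g (N + 1) j m"
    obtain K where K: "K > 0" "((\<lambda>q. coeff (?c q) j / q powr ?e) \<longlongrightarrow> (-1) ^ m * K) (at_right 0)"
      unfolding heun_c_eq_jacobi_poly
    \<comment> \<open>The numerators have limits 1, \<open>t1\<close> and 1; \<open>D\<close>
      contributes \<open>t1 * t2\<close> and shifts each exponent by
      \<open>- (h1 + h2)\<close>.\<close>
    proof (rule coeff_jacobi_poly_tendsto[where M = "N + 1" and m = m and j = j and a = a and b = b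
          and g = g and U = "\<lambda>_. 1 / (t1 * t2)" and V = "\<lambda>_. t1 / (t1 * t2)"
          and W = "\<lambda>_. 1 / (t1 * t2)"])
      fix n assume n: "1 \<le> n" "n \<le> N + 1"
      show "((\<lambda>q. coeff (heun_A h1 h2 l1 l2 \<alpha>1 \<alpha>2 \<beta> t1 t2 q n) 1 / heun_D h1 h2 \<beta> t1 t2 q n
          / q powr (real n - 1 + g)) \<longlongrightarrow> 1 / (t1 * t2)) (at_right 0)"
        by (rule tendsto_divide_divide_powr[OF heun_A_coeff_1_tendsto D[OF n(1)] t(1)])
          (simp add: g_def)
      have "2 * real n - 1 + h2 - l2 - \<beta> < 0" using n(2) assms(8) by linarith
      from heun_A_coeff_0_tendsto[OF this assms(6,7)]
      show "((\<lambda>q. coeff (heun_A h1 h2 l1 l2 \<alpha>1 \<alpha>2 \<beta> t1 t2 q n) 0 / heun_D h1 h2 \<beta> t1 t2 q n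
          / q powr (2 * real n + a)) \<longlongrightarrow> t1 / (t1 * t2)) (at_right 0)"
        by (rule tendsto_divide_divide_powr[OF _ D[OF n(1)] t(1)]) (simp add: a_def)
    next
      fix n assume n: "2 \<le> n" "n \<le> N + 1"
      \<comment> \<open>As \<open>?\<mu> + \<alpha>1 = - N\<close>, the first is at most -1; the
        second exceeds it by \<open>\<alpha>2 - \<alpha>1 < 1\<close>.\<close>
      have "real n - 2 + ?\<mu> + \<alpha>1 < 0" "real n - 2 + ?\<mu> + \<alpha>2 < 0"
        using n(2) assms(1,3) by linarith+
      from heun_B_tendsto[OF this]
      show "((\<lambda>q. heun_B h1 h2 l1 l2 \<alpha>1 \<alpha>2 \<beta> q n / heun_D h1 h2 \<beta> t1 t2 q n
          / q powr (2 * real n - 1 + b)) \<longlongrightarrow> 1 / (t1 * t2)) (at_right 0)"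
        using n by (intro tendsto_divide_divide_powr[OF _ D t(1)]) (auto simp: b_def)
    qed (use assms(4,5) t m in auto)
    have one: "((\<lambda>q::real. q powr r / q powr r) \<longlongrightarrow> 1) (at_right 0)" for r
      using monomial_divide_powr_tendsto[of r r 1] by simp
    obtain K' where K': "K' > 0"
      "((\<lambda>q. coeff (?c' q) j / q powr ?e) \<longlongrightarrow> (-1) ^ m * K') (at_right 0)"
      unfolding heun_c_tilde_eq_jacobi_poly g_def[symmetric] a_def[symmetric] b_def[symmetric]
    \<comment> \<open>The weights are exact powers, except that \<open>W\<close> is 0 at the
      suppressed dimers.\<close>
    proof (rule coeff_jacobi_poly_tendsto[where M = "N + 1" and m = m and j = j and a = a and b = b
          and g = g and u = "\<lambda>q n. q powr (real n - 1 + g)" and v = "\<lambda>q n. q powr (2 * real n + a)"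
          and U = "\<lambda>_. 1" and V = "\<lambda>_. 1"
          and W = "\<lambda>n. if even (N + 1 + n) then 1 else 0"])
      fix n
      show "((\<lambda>q. (if even (N + 1 + n) then q powr (2 * real n - 1 + b) else 0)
          / q powr (2 * real n - 1 + b)) \<longlongrightarrow> (if even (N + 1 + n) then 1 else 0)) (at_right 0)"
        using one by simp
    qed (rule one m | assumption | simp)+
    \<comment> \<open>The common exponent and the common sign \<open>(-1) ^ m\<close> cancel,
      leaving the positive constant \<open>K / K'\<close>.\<close>
    have "((\<lambda>q. coeff (?c q) j / coeff (?c' q) j / q powr 0)
        \<longlongrightarrow> (-1) ^ m * K / ((-1) ^ m * K')) (at_right 0)"
      using K'(1) by (intro tendsto_divide_divide_powr[OF K(2) K'(2)]) auto
    moreover have "(-1) ^ m * K / ((-1) ^ m * K') = K / K'" by simp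
    moreover have "\<forall>\<^sub>F q in at_right (0::real).
        coeff (?c q) j / coeff (?c' q) j / q powr 0 = coeff (?c q) j / coeff (?c' q) j"
      by (rule eventually_mono[OF eventually_at_right_less]) simp
    ultimately have "((\<lambda>q. coeff (?c q) j / coeff (?c' q) j) \<longlongrightarrow> K / K') (at_right 0)"
      using Lim_transform_eventually by fastforce
    then show ?thesis
      unfolding asymp_sim_def using divide_pos_pos[OF K(1) K'(1)] by blast
  qed
  moreover have "degree (?c q) \<le> N + 1" "degree (?c' q) \<le> N + 1" for q
    unfolding heun_c_eq_jacobi_poly heun_c_tilde_eq_jacobi_poly by (rule degree_jacobi_poly)+
  ultimately show ?thesis unfolding poly_asymp_sim_def by blast
qed

end
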